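(* For any non-trivial algebra $\mathcal{A}$ (finite and with finite signature), $$|\mathrm{PSpec}(\mathcal{A})|\;\geq\;\sup_{k\geq 1}\left\lfloor\frac{1}{4\,(1-\mathrm{Prim}_k(\mathcal{A}))}\right\rfloor .$$ In particular, $$|\mathrm{PSpec}(\mathcal{A})|\;\geq\;\left\lfloor\frac{1}{4\,(1-\mathrm{Prim}(\mathcal{A}))}\right\rfloor .$$
   Context: Algebras are algebras in the sense of universal algebra, all finite and with a finite signature; $A$ denotes the universe of $\mathcal{A}$, and non-trivial means that $A$ has at least two elements. A term is an element of the absolutely free algebra, in the given signature, over an infinite set of variables; a term with $k$ variables is interpreted in $\mathcal{A}$ as a function $A^k\to A$. An equation $t\approx t'$ is an ordered pair of terms in the signature; its number of variables $k$ is the total number of distinct variables appearing in it. The probability of an equation $t\approx t'$ with $k$ variables over $\mathcal{A}$ is $$\Pr(t\approx t'\mid\mathcal{A})=\frac{|\{\vec{x}\in A^k\mid t(\vec{x})=t'(\vec{x})\}|}{|A|^k},$$ and the equational probabilistic spectrum of $\mathcal{A}$ is $\mathrm{PSpec}(\mathcal{A})=\{\Pr(t\approx t'\mid\mathcal{A})\mid t\approx t' \text{ an equation in the signature of }\mathcal{A}\}$. For $k\geq 1$ and $f,g:A^k\to A$ the coincidence ratio is $$\mu(f,g)=\frac{|\{\vec{x}\in A^k\mid f(\vec{x})=g(\vec{x})\}|}{|A|^k}.$$ $\mathrm{Clo}(\mathcal{A})$ is the clone of functions generated by the operations of $\mathcal{A}$, $\mathrm{Clo}_k(\mathcal{A})$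 is the set of its members of arity $k$, and $\mathcal{F}_k(\mathcal{A})$ is the set of all functions $A^k\to A$. For each $k\geq 1$ the arity-$k$ primality of $\mathcal{A}$ is $$\mathrm{Prim}_k(\mathcal{A})=\min_{f\in\mathcal{F}_k(\mathcal{A})}\ \max_{t\in\mathrm{Clo}_k(\mathcal{A})}\mu(f,t),$$ and the primality of $\mathcal{A}$ is $\mathrm{Prim}(\mathcal{A})=\inf_{k\geq1}\mathrm{Prim}_k(\mathcal{A})$.
   Formalization: The supremum is taken only over k with Prim_k < 1, since the bound is undefined at Prim_k = 1 and false there if read as infinity ({0,1} with negation and constants: Prim_1 = 1, |PSpec| = 3); for Prim = 1 the second bound is read as infinity. *)

theory Defs
  imports Complex_Main "HOL-Library.FuncSet" "HOL-Library.Extended_Nat"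
begin

section \<open>Finite algebras with finite signature\<close>

record ('f, 'a) algebra =
  universe :: "'a set"
  symbols :: "'f set"
  arity :: "'f \<Rightarrow> nat"
  oper :: "'f \<Rightarrow> 'a list \<Rightarrow> 'a"

text \<open>The set $A^k$, its elements being represented as lists of length $k$.\<close>

definition tuples :: "'a set \<Rightarrow> nat \<Rightarrow> 'a list set" where
  "tuples A k = {xs. set xs \<subseteq> A \<and> length xs = k}"

text \<open>Operation symbols of arity 0 (constants) are allowed.\<close>

locale finite_algebra =
  fixes \<A> :: "('f, 'a) algebra"
  assumes finite_universe: "finite (universe \<A>)"
    and universe_nonempty: "universe \<A> \<noteq> {}"
    and finite_symbols: "finite (symbols \<A>)"
    and oper_closed:
      "f \<in> symbols \<A> \<Longrightarrow> xs \<in> tuples (universe \<A>) (arity \<A> f) \<Longrightarrow> oper \<A> f xs \<in> universe \<A>"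

definition nontrivial :: "('f, 'a) algebra \<Rightarrow> bool" where
  "nontrivial \<A> \<longleftrightarrow> (\<exists>a\<in>universe \<A>. \<exists>b\<in>universe \<A>. a \<noteq> b)"


section \<open>Equations and the equational probabilistic spectrum\<close>

datatype 'f trm = Var nat | Op 'f "'f trm list"

primrec trm_vars :: "'f trm \<Rightarrow> nat set" where
  "trm_vars (Var i) = {i}"
| "trm_vars (Op f ts) = \<Union> (set (map trm_vars ts))"

inductive_set trms :: "('f, 'a) algebra \<Rightarrow> 'f trm set" for \<A> where
  Var: "Var i \<in> trms \<A>"
| Op: "f \<in> symbols \<A> \<Longrightarrow> length ts = arity \<A> f \<Longrightarrow> (\<And>t. t \<in> set ts \<Longrightarrow> t \<in> trms \<A>)
    \<Longrightarrow> Op f ts \<in> trms \<A>"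

primrec trm_val :: "('f, 'a) algebra \<Rightarrow> (nat \<Rightarrow> 'a) \<Rightarrow> 'f trm \<Rightarrow> 'a" where
  "trm_val \<A> x (Var i) = x i"
| "trm_val \<A> x (Op f ts) = oper \<A> f (map (trm_val \<A> x) ts)"

definition eq_vars :: "'f trm \<times> 'f trm \<Rightarrow> nat set" where
  "eq_vars e = trm_vars (fst e) \<union> trm_vars (snd e)"

text \<open>For an equation with exactly $k$ distinct variables, $A^k$ is here indexed by the set of
  these variables, so that no enumeration of them has to be chosen.\<close>

definition eq_prob :: "('f, 'a) algebra \<Rightarrow> 'f trm \<times> 'f trm \<Rightarrow> real" where
  "eq_prob \<A> e =
     real (card {x \<in> eq_vars e \<rightarrow>\<^sub>E universe \<A>. trm_val \<A> x (fst e) = trm_val \<A> x (snd e)})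
       / real (card (universe \<A>)) ^ card (eq_vars e)"

definition PSpec :: "('f, 'a) algebra \<Rightarrow> real set" where
  "PSpec \<A> = eq_prob \<A> ` (trms \<A> \<times> trms \<A>)"


section \<open>Clones and primality\<close>

definition funs :: "('f, 'a) algebra \<Rightarrow> nat \<Rightarrow> ('a list \<Rightarrow> 'a) set" where
  "funs \<A> k = tuples (universe \<A>) k \<rightarrow>\<^sub>E universe \<A>"

text \<open>\<open>Clo \<A> k\<close> is the set of \<open>k\<close>-ary members of the clone generated by the operations: the least
  family containing the operations and the projections and closed under composition. All functions
  are extensional on \<open>A\<^sup>k\<close>, so that equality is equality of functions on \<open>A\<^sup>k\<close>.\<close>

inductive_set clone :: "('f, 'a) algebra \<Rightarrow> (nat \<times> ('a list \<Rightarrow> 'a)) set" for \<A> where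
  basic: "f \<in> symbols \<A> \<Longrightarrow>
    (arity \<A> f, restrict (oper \<A> f) (tuples (universe \<A>) (arity \<A> f))) \<in> clone \<A>"
| proj: "i < k \<Longrightarrow> (k, restrict (\<lambda>xs. xs ! i) (tuples (universe \<A>) k)) \<in> clone \<A>"
| comp: "(n, h) \<in> clone \<A> \<Longrightarrow> length gs = n \<Longrightarrow> (\<And>g. g \<in> set gs \<Longrightarrow> (k, g) \<in> clone \<A>) \<Longrightarrow>
    (k, restrict (\<lambda>xs. h (map (\<lambda>g. g xs) gs)) (tuples (universe \<A>) k)) \<in> clone \<A>"

definition Clo :: "('f, 'a) algebra \<Rightarrow> nat \<Rightarrow> ('a list \<Rightarrow> 'a) set" where
  "Clo \<A> k = {f. (k, f) \<in> clone \<A>}"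

definition coincidence_ratio ::
    "('f, 'a) algebra \<Rightarrow> nat \<Rightarrow> ('a list \<Rightarrow> 'a) \<Rightarrow> ('a list \<Rightarrow> 'a) \<Rightarrow> real" where
  "coincidence_ratio \<A> k f g =
     real (card {xs \<in> tuples (universe \<A>) k. f xs = g xs}) / real (card (universe \<A>)) ^ k"

definition Prim_k :: "('f, 'a) algebra \<Rightarrow> nat \<Rightarrow> real" where
  "Prim_k \<A> k = (MIN f\<in>funs \<A> k. MAX t\<in>Clo \<A> k. coincidence_ratio \<A> k f t)"

definition Prim :: "('f, 'a) algebra \<Rightarrow> real" where
  "Prim \<A> = (INF k\<in>{1..}. Prim_k \<A> k)"

text \<open>The minima and maxima in the definition of \<open>Prim_k\<close> range over finite nonempty sets.\<close>

context finite_algebra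
begin

lemma clone_funs: "(k, f) \<in> clone \<A> \<Longrightarrow> f \<in> funs \<A> k"
proof (induction k f rule: clone.induct)
  case (basic f)
  then show ?case unfolding funs_def restrict_PiE_iff by (auto intro: oper_closed)
next
  case (proj i k)
  then show ?case unfolding funs_def restrict_PiE_iff
    by (auto simp: tuples_def intro: subsetD[OF _ nth_mem])
next
  case (comp n h gs k)
  have "map (\<lambda>g. g xs) gs \<in> tuples (universe \<A>) n" if "xs \<in> tuples (universe \<A>) k" for xs
    unfolding tuples_def using comp.IH(2) comp.hyps(2) that by (auto simp: funs_def dest: PiE_mem)
  then show ?case using comp.IH(1) unfolding funs_def restrict_PiE_iff by (auto dest: PiE_mem)
qed

lemma finite_funs: "finite (funs \<A> k)"
  unfolding funs_def tuples_def
  by (intro finite_PiE finite_lists_length_eq finite_universe)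

lemma funs_nonempty: "funs \<A> k \<noteq> {}"
  using universe_nonempty by (simp add: funs_def PiE_eq_empty_iff)

lemma finite_Clo: "finite (Clo \<A> k)"
  by (rule finite_subset[OF _ finite_funs[of k]]) (auto simp: Clo_def clone_funs)

lemma Clo_nonempty: "k \<ge> 1 \<Longrightarrow> Clo \<A> k \<noteq> {}"
  using clone.proj[of 0 k \<A>] by (auto simp: Clo_def)

end


section \<open>The bound\<close>

definition ecard :: "'b set \<Rightarrow> enat" where
  "ecard S = (if finite S then enat (card S) else \<infinity>)"

text \<open>The value $\lfloor 1/(4(1-p)) \rfloor$ for $p \le 1$, with $1/0 = \infty$.\<close>

definition primality_bound :: "real \<Rightarrow> enat" where
  "primality_bound p = (if p < 1 then enat (nat \<lfloor>1 / (4 * (1 - p))\<rfloor>) else \<infinity>)"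

text \<open>In the supremum over $k$, only those $k$ with $\mathrm{Prim}_k < 1$ are admitted, as
  $1/(4(1-\mathrm{Prim}_k))$ is undefined for the others. Reading it as $\infty$ there would be wrong:
  the two-element algebra whose operations are negation and the two constants has
  $\mathrm{Prim}_1 = 1$, but its spectrum is $\{0, 1/2, 1\}$.\<close>

end

theory Submission
  imports Defs
begin

text \<open>Write \<open>n\<close> for the size of the universe and let \<open>k \<ge> 1\<close>. Coincidence ratios of \<open>k\<close>-ary
  functions are multiples of \<open>1 / n ^ k\<close>, so \<open>Prim_k \<A> k = 1 - e / n ^ k\<close> for some natural number \<open>e\<close>, and
  every \<open>k\<close>-ary function differs from some member of the clone in at most \<open>e\<close> points
  (\<open>Prim_k_defect\<close>).

  Since there are at least two elements, each number \<open>j \<le> n ^ k\<close> is the number of points at which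
  some function agrees with the first projection (\<open>exists_fun_with_agreement\<close>). Replacing that
  function by a term function that differs from it in at most \<open>e\<close> points, and using that the
  projection is itself a term function, one obtains an equation \<open>t \<approx> x\<^sub>0\<close> with probability
  \<open>c / n ^ k\<close> and \<open>\<bar>c - j\<bar> \<le> e\<close>. Values of \<open>j\<close> at distance \<open>2 e + 1\<close> from one another therefore give
  distinct probabilities, which yields more than \<open>n ^ k div (2 e + 1)\<close> elements of the spectrum
  (\<open>card_PSpec_greater\<close>).

  If \<open>Prim_k \<A> k < 1\<close>, then \<open>e \<ge> 1\<close>, so \<open>2 e + 1 \<le> 4 e\<close>, and \<open>n ^ k div (4 e)\<close> is the bound claimed.
  If \<open>Prim \<A> = 1\<close>, then \<open>e = 0\<close> for every \<open>k\<close>, and the spectrum has more than \<open>n ^ k\<close> elements for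
  every \<open>k\<close>, so it is infinite. Otherwise some \<open>k\<close> has \<open>Prim \<A> \<le> Prim_k \<A> k < 1\<close>, and the
  monotonicity of the bound reduces the statement on \<open>Prim \<A>\<close> to the one on this \<open>k\<close>.\<close>


section \<open>Clone members as term functions\<close>

lemma trm_val_cong:
  assumes "\<And>i. i \<in> trm_vars t \<Longrightarrow> x i = y i"
  shows "trm_val \<A> x t = trm_val \<A> y t"
  using assms
proof (induction t)
  case (Op f ts)
  then have "map (trm_val \<A> x) ts = map (trm_val \<A> y) ts"
    by (intro map_cong) auto
  then show ?case by (simp only: trm_val.simps)
qed simp

primrec trm_subst :: "(nat \<Rightarrow> 'f trm) \<Rightarrow> 'f trm \<Rightarrow> 'f trm" where
  "trm_subst \<sigma> (Var i) = \<sigma> i"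
| "trm_subst \<sigma> (Op f ts) = Op f (map (trm_subst \<sigma>) ts)"

lemma trm_vars_subst: "trm_vars (trm_subst \<sigma> t) = (\<Union>i\<in>trm_vars t. trm_vars (\<sigma> i))"
  by (induction t) auto

lemma trm_val_subst: "trm_val \<A> x (trm_subst \<sigma> t) = trm_val \<A> (\<lambda>i. trm_val \<A> x (\<sigma> i)) t"
proof (induction t)
  case (Op f ts)
  then have "map (trm_val \<A> x) (map (trm_subst \<sigma>) ts) = map (trm_val \<A> (\<lambda>i. trm_val \<A> x (\<sigma> i))) ts"
    by simp
  then show ?case by (simp only: trm_subst.simps trm_val.simps)
qed simp

lemma trms_subst:
  assumes "t \<in> trms \<A>" "\<And>i. i \<in> trm_vars t \<Longrightarrow> \<sigma> i \<in> trms \<A>"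
  shows "trm_subst \<sigma> t \<in> trms \<A>"
  using assms
proof (induction rule: trms.induct)
  case (Op f ts)
  have "trm_subst \<sigma> t \<in> trms \<A>" if "t \<in> set ts" for t
    using that Op.prems by (intro Op.IH) auto
  with Op.hyps show ?case by (auto intro!: trms.Op)
qed simp

context finite_algebra
begin

text \<open>A composition of clone members is represented by substituting the terms of the inner functions
  into the term of the outer one.\<close>

lemma clone_imp_term:
  assumes "(k, g) \<in> clone \<A>"
  shows "\<exists>t\<in>trms \<A>. trm_vars t \<subseteq> {..<k} \<and>
    (\<forall>xs\<in>tuples (universe \<A>) k. g xs = trm_val \<A> ((!) xs) t)"
  using assms
proof (induction rule: clone.induct)
  case (basic f)
  let ?t = "Op f (map Var [0..<arity \<A> f])"
  have "?t \<in> trms \<A>" using basic by (auto intro!: trms.intros)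
  moreover have "trm_val \<A> ((!) xs) ?t = oper \<A> f xs" if "xs \<in> tuples (universe \<A>) (arity \<A> f)" for xs
    using that map_nth[of xs] by (simp add: tuples_def comp_def)
  moreover have "trm_vars ?t \<subseteq> {..<arity \<A> f}" by auto
  ultimately show ?case by (intro bexI[of _ ?t]) simp_all
next
  case (proj i k)
  then show ?case by (intro bexI[of _ "Var i"]) (auto intro: trms.Var)
next
  case (comp n h gs k)
  from comp.IH(1) obtain th where th: "th \<in> trms \<A>" "trm_vars th \<subseteq> {..<n}"
    "\<And>ys. ys \<in> tuples (universe \<A>) n \<Longrightarrow> h ys = trm_val \<A> ((!) ys) th" by blast
  have "\<forall>g\<in>set gs. \<exists>t. t \<in> trms \<A> \<and> trm_vars t \<subseteq> {..<k} \<and>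
      (\<forall>xs\<in>tuples (universe \<A>) k. g xs = trm_val \<A> ((!) xs) t)"
    using comp.IH(2) by (simp only: Bex_def) simp
  from bchoice[OF this] obtain T where T: "\<And>g. g \<in> set gs \<Longrightarrow> T g \<in> trms \<A>"
    "\<And>g. g \<in> set gs \<Longrightarrow> trm_vars (T g) \<subseteq> {..<k}"
    "\<And>g xs. g \<in> set gs \<Longrightarrow> xs \<in> tuples (universe \<A>) k \<Longrightarrow> g xs = trm_val \<A> ((!) xs) (T g)"
    by auto
  let ?t = "trm_subst (\<lambda>i. T (gs ! i)) th"
  have nth: "gs ! i \<in> set gs" if "i \<in> trm_vars th" for i
    using that th(2) comp.hyps(2) by auto
  have "?t \<in> trms \<A>"
    by (rule trms_subst[OF th(1)]) (rule T(1)[OF nth])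
  moreover have "trm_vars ?t \<subseteq> {..<k}"
    unfolding trm_vars_subst by (rule UN_least) (rule T(2)[OF nth])
  moreover have "h (map (\<lambda>g. g xs) gs) = trm_val \<A> ((!) xs) ?t" if xs: "xs \<in> tuples (universe \<A>) k" for xs
  proof -
    have "g xs \<in> universe \<A>" if "g \<in> set gs" for g
      using PiE_mem[OF clone_funs[OF comp.hyps(3)[OF that], unfolded funs_def] xs] .
    then have "map (\<lambda>g. g xs) gs \<in> tuples (universe \<A>) n"
      using comp.hyps(2) by (auto simp: tuples_def)
    then have "h (map (\<lambda>g. g xs) gs) = trm_val \<A> ((!) (map (\<lambda>g. g xs) gs)) th" by (rule th(3))
    also have "\<dots> = trm_val \<A> (\<lambda>i. trm_val \<A> ((!) xs) (T (gs ! i))) th"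
    proof (rule trm_val_cong)
      fix i assume i: "i \<in> trm_vars th"
      then have "i < length gs" using th(2) comp.hyps(2) by auto
      then show "map (\<lambda>g. g xs) gs ! i = trm_val \<A> ((!) xs) (T (gs ! i))"
        using T(3)[OF nth[OF i] xs] by simp
    qed
    finally show ?thesis by (simp add: trm_val_subst)
  qed
  ultimately show ?case by (intro bexI[of _ ?t]) simp_all
qed

end


section \<open>Dummy variables\<close>

text \<open>Restriction to \<open>V\<close> and to \<open>W - V\<close> splits the assignments to \<open>W\<close> into a product, and only the
  first factor affects \<open>P\<close>.\<close>

lemma card_PiE_dummy_coordinates:
  assumes "finite W" "V \<subseteq> W"
    and dep: "\<And>x y. (\<And>i. i \<in> V \<Longrightarrow> x i = y i) \<Longrightarrow> P x \<longleftrightarrow> P y"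
  shows "card {x \<in> W \<rightarrow>\<^sub>E A. P x} = card {x \<in> V \<rightarrow>\<^sub>E A. P x} * card A ^ card (W - V)"
proof -
  let ?S = "{x \<in> W \<rightarrow>\<^sub>E A. P x}"
  let ?T = "{x \<in> V \<rightarrow>\<^sub>E A. P x} \<times> ((W - V) \<rightarrow>\<^sub>E A)"
  have "bij_betw (\<lambda>x. (restrict x V, restrict x (W - V))) ?S ?T"
  proof (rule bij_betw_byWitness[where f' = "\<lambda>(y, z) i. if i \<in> V then y i else z i"])
    show "\<forall>x\<in>?S. (case (restrict x V, restrict x (W - V)) of
        (y, z) \<Rightarrow> \<lambda>i. if i \<in> V then y i else z i) = x"
      using assms(2) by (auto simp: fun_eq_iff PiE_def extensional_def)
    show "\<forall>yz\<in>?T. (\<lambda>x. (restrict x V, restrict x (W - V)))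
        (case yz of (y, z) \<Rightarrow> \<lambda>i. if i \<in> V then y i else z i) = yz"
      by (auto simp: fun_eq_iff PiE_def extensional_def)
    show "(\<lambda>x. (restrict x V, restrict x (W - V))) ` ?S \<subseteq> ?T"
    proof (rule image_subsetI)
      fix x assume x: "x \<in> ?S"
      have mem: "x i \<in> A" if "i \<in> W" for i using x that by (auto intro: PiE_mem)
      have "P (restrict x V)" using iffD1[OF dep[of x "restrict x V"]] x by simp
      moreover have "restrict x V \<in> V \<rightarrow>\<^sub>E A" "restrict x (W - V) \<in> (W - V) \<rightarrow>\<^sub>E A"
        using mem assms(2) by (simp_all add: restrict_PiE_iff subset_iff)
      ultimately show "(restrict x V, restrict x (W - V)) \<in> ?T" by blast
    qed
    show "(\<lambda>(y, z) i. if i \<in> V then y i else z i) ` ?T \<subseteq> ?S"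
    proof (rule image_subsetI)
      fix yz assume "yz \<in> ?T"
      then obtain y z where yz: "yz = (y, z)" and y: "y \<in> V \<rightarrow>\<^sub>E A" "P y" and z: "z \<in> (W - V) \<rightarrow>\<^sub>E A"
        by blast
      have "P (\<lambda>i. if i \<in> V then y i else z i)"
        using iffD1[OF dep[of y "\<lambda>i. if i \<in> V then y i else z i"]] y(2) by simp
      moreover have "(\<lambda>i. if i \<in> V then y i else z i) \<in> W \<rightarrow>\<^sub>E A"
        using y(1) z assms(2) by (auto simp: PiE_def extensional_def Pi_def)
      ultimately show "(case yz of (y, z) \<Rightarrow> \<lambda>i. if i \<in> V then y i else z i) \<in> ?S"
        using yz by simp
    qed
  qed
  then have "card ?S = card ?T" by (rule bij_betw_same_card)
  also have "\<dots> = card {x \<in> V \<rightarrow>\<^sub>E A. P x} * card A ^ card (W - V)"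
    using assms(1) by (simp add: card_cartesian_product card_PiE)
  finally show ?thesis .
qed

lemma card_tuples_conv_PiE:
  assumes dep: "\<And>x y. (\<And>i. i < k \<Longrightarrow> x i = y i) \<Longrightarrow> P x \<longleftrightarrow> P y"
  shows "card {xs \<in> tuples A k. P ((!) xs)} = card {x \<in> {..<k} \<rightarrow>\<^sub>E A. P x}"
proof -
  have "bij_betw (\<lambda>xs. restrict ((!) xs) {..<k}) {xs \<in> tuples A k. P ((!) xs)} {x \<in> {..<k} \<rightarrow>\<^sub>E A. P x}"
  proof (rule bij_betw_byWitness[where f' = "\<lambda>x. map x [0..<k]"])
    show "\<forall>xs\<in>{xs \<in> tuples A k. P ((!) xs)}. map (restrict ((!) xs) {..<k}) [0..<k] = xs"
      by (auto simp: tuples_def intro!: nth_equalityI)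
    show "\<forall>x\<in>{x \<in> {..<k} \<rightarrow>\<^sub>E A. P x}. restrict ((!) (map x [0..<k])) {..<k} = x"
      by (auto simp: fun_eq_iff PiE_def extensional_def)
    show "(\<lambda>xs. restrict ((!) xs) {..<k}) ` {xs \<in> tuples A k. P ((!) xs)} \<subseteq> {x \<in> {..<k} \<rightarrow>\<^sub>E A. P x}"
    proof (rule image_subsetI)
      fix xs assume xs: "xs \<in> {xs \<in> tuples A k. P ((!) xs)}"
      have "P (restrict ((!) xs) {..<k})"
        using iffD1[OF dep[of "(!) xs" "restrict ((!) xs) {..<k}"]] xs by simp
      moreover have "xs ! i \<in> A" if "i < k" for i
        using xs nth_mem[of i xs] that unfolding tuples_def by blast
      then have "restrict ((!) xs) {..<k} \<in> {..<k} \<rightarrow>\<^sub>E A"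
        by (simp add: restrict_PiE_iff)
      ultimately show "restrict ((!) xs) {..<k} \<in> {x \<in> {..<k} \<rightarrow>\<^sub>E A. P x}" by blast
    qed
    show "(\<lambda>x. map x [0..<k]) ` {x \<in> {..<k} \<rightarrow>\<^sub>E A. P x} \<subseteq> {xs \<in> tuples A k. P ((!) xs)}"
    proof (rule image_subsetI)
      fix x assume x: "x \<in> {x \<in> {..<k} \<rightarrow>\<^sub>E A. P x}"
      then have "x i \<in> A" if "i < k" for i using PiE_mem[of x "{..<k}" "\<lambda>_. A" i] that by simp
      then have "map x [0..<k] \<in> tuples A k"
        by (simp add: tuples_def image_subset_iff)
      moreover have "P ((!) (map x [0..<k]))"
        using iffD1[OF dep[of x "(!) (map x [0..<k])"]] x by simp
      ultimately show "map x [0..<k] \<in> {xs \<in> tuples A k. P ((!) xs)}" by blast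
    qed
  qed
  then show ?thesis by (rule bij_betw_same_card)
qed

context finite_algebra
begin

lemma card_universe_pos: "card (universe \<A>) > 0"
  using finite_universe universe_nonempty by (simp add: card_gt_0_iff)

text \<open>The spectrum counts assignments to the variables that occur in an equation, the clone works
  with a fixed arity. Variables below \<open>k\<close> that do not occur multiply both the solutions and the
  assignments by \<open>n\<close> each, so the ratio does not depend on the convention.\<close>

lemma eq_prob_tuples:
  assumes "eq_vars (s, t) \<subseteq> {..<k}"
  shows "eq_prob \<A> (s, t) =
    real (card {xs \<in> tuples (universe \<A>) k. trm_val \<A> ((!) xs) s = trm_val \<A> ((!) xs) t})
      / real (card (universe \<A>)) ^ k"
proof -
  let ?V = "eq_vars (s, t)"
  let ?P = "\<lambda>x. trm_val \<A> x s = trm_val \<A> x t"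
  let ?n = "real (card (universe \<A>))"
  have dep: "?P x \<longleftrightarrow> ?P y" if "\<And>i. i \<in> ?V \<Longrightarrow> x i = y i" for x y
    using trm_val_cong[of s x y \<A>] trm_val_cong[of t x y \<A>] that by (auto simp: eq_vars_def)
  have fin: "finite ?V" using assms finite_subset by blast
  have k: "k = card ?V + card ({..<k} - ?V)"
    using card_Diff_subset[OF fin assms] card_mono[OF _ assms] by simp
  have "card {xs \<in> tuples (universe \<A>) k. ?P ((!) xs)} = card {x \<in> {..<k} \<rightarrow>\<^sub>E universe \<A>. ?P x}"
  proof (rule card_tuples_conv_PiE[where P = ?P])
    fix x y :: "nat \<Rightarrow> 'a"
    assume "\<And>i. i < k \<Longrightarrow> x i = y i"
    then have "x i = y i" if "i \<in> ?V" for i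
      using that assms by blast
    then show "?P x \<longleftrightarrow> ?P y" by (rule dep)
  qed
  also have "\<dots> = card {x \<in> ?V \<rightarrow>\<^sub>E universe \<A>. ?P x} * card (universe \<A>) ^ card ({..<k} - ?V)"
    by (rule card_PiE_dummy_coordinates[where P = ?P]) (rule finite_lessThan, rule assms, erule dep)
  finally have "real (card {xs \<in> tuples (universe \<A>) k. ?P ((!) xs)}) / ?n ^ k
      = real (card {x \<in> ?V \<rightarrow>\<^sub>E universe \<A>. ?P x}) * ?n ^ card ({..<k} - ?V)
        / (?n ^ card ?V * ?n ^ card ({..<k} - ?V))"
    by (subst (2) k) (simp add: power_add)
  also have "\<dots> = real (card {x \<in> ?V \<rightarrow>\<^sub>E universe \<A>. ?P x}) / ?n ^ card ?V"
    using card_universe_pos by simp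
  finally show ?thesis by (simp add: eq_prob_def)
qed

lemma agreement_with_projection_in_PSpec:
  assumes "g \<in> Clo \<A> k" "i < k"
  shows "real (card {xs \<in> tuples (universe \<A>) k. g xs = xs ! i}) / real (card (universe \<A>)) ^ k \<in> PSpec \<A>"
proof -
  obtain t where t: "t \<in> trms \<A>" "trm_vars t \<subseteq> {..<k}"
    "\<And>xs. xs \<in> tuples (universe \<A>) k \<Longrightarrow> g xs = trm_val \<A> ((!) xs) t"
    using clone_imp_term assms(1) unfolding Clo_def by blast
  have "{xs \<in> tuples (universe \<A>) k. g xs = xs ! i} =
      {xs \<in> tuples (universe \<A>) k. trm_val \<A> ((!) xs) t = trm_val \<A> ((!) xs) (Var i)}"
    using t(3) by auto
  moreover have "eq_vars (t, Var i) \<subseteq> {..<k}"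
    using t(2) assms(2) by (auto simp: eq_vars_def)
  ultimately have "real (card {xs \<in> tuples (universe \<A>) k. g xs = xs ! i}) / real (card (universe \<A>)) ^ k
      = eq_prob \<A> (t, Var i)"
    by (simp only: eq_prob_tuples)
  then show ?thesis using t(1) by (auto simp: PSpec_def intro: trms.Var)
qed


section \<open>Primality as a number of points\<close>

lemma finite_tuples: "finite (tuples (universe \<A>) k)"
  unfolding tuples_def by (intro finite_lists_length_eq finite_universe)

lemma card_tuples: "card (tuples (universe \<A>) k) = card (universe \<A>) ^ k"
  unfolding tuples_def by (intro card_lists_length_eq finite_universe)

lemma coincidence_ratio_defect:
  "coincidence_ratio \<A> k f g =
    1 - real (card {xs \<in> tuples (universe \<A>) k. f xs \<noteq> g xs}) / real (card (universe \<A>)) ^ k"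
proof -
  let ?T = "tuples (universe \<A>) k"
  have "?T = {xs \<in> ?T. f xs = g xs} \<union> {xs \<in> ?T. f xs \<noteq> g xs}" by blast
  moreover have "card ({xs \<in> ?T. f xs = g xs} \<union> {xs \<in> ?T. f xs \<noteq> g xs})
      = card {xs \<in> ?T. f xs = g xs} + card {xs \<in> ?T. f xs \<noteq> g xs}"
    by (rule card_Un_disjoint) (simp_all add: finite_tuples disjoint_iff)
  ultimately have "card ?T = card {xs \<in> ?T. f xs = g xs} + card {xs \<in> ?T. f xs \<noteq> g xs}"
    by simp
  then have "real (card {xs \<in> ?T. f xs = g xs})
      = real (card (universe \<A>)) ^ k - real (card {xs \<in> ?T. f xs \<noteq> g xs})"
    by (simp add: card_tuples flip: of_nat_power)
  then show ?thesis
    using card_universe_pos by (simp add: coincidence_ratio_def diff_divide_distrib)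
qed

text \<open>Both extrema in the definition of primality are attained, so primality is the coincidence
  ratio of two particular functions, and \<open>e\<close> counts the points at which these differ.\<close>

lemma Prim_k_defect:
  assumes "k \<ge> 1"
  shows "\<exists>e. Prim_k \<A> k = 1 - real e / real (card (universe \<A>)) ^ k \<and>
    (\<forall>f\<in>funs \<A> k. \<exists>t\<in>Clo \<A> k. card {xs \<in> tuples (universe \<A>) k. f xs \<noteq> t xs} \<le> e)"
proof -
  let ?M = "\<lambda>f. MAX t\<in>Clo \<A> k. coincidence_ratio \<A> k f t"
  let ?d = "\<lambda>f t. card {xs \<in> tuples (universe \<A>) k. f xs \<noteq> t xs}"
  have M_in: "\<exists>t\<in>Clo \<A> k. ?M f = coincidence_ratio \<A> k f t" for f
  proof -
    have "?M f \<in> coincidence_ratio \<A> k f ` Clo \<A> k"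
      by (rule Max_in) (simp_all add: finite_Clo Clo_nonempty[OF assms])
    then show ?thesis by blast
  qed
  have "Prim_k \<A> k \<in> ?M ` funs \<A> k"
    unfolding Prim_k_def by (intro Min_in) (auto simp: finite_funs funs_nonempty)
  then obtain f t where ft: "Prim_k \<A> k = coincidence_ratio \<A> k f t"
    using M_in by fastforce
  have eq: "Prim_k \<A> k = 1 - real (?d f t) / real (card (universe \<A>)) ^ k"
    using ft coincidence_ratio_defect by simp
  moreover have "\<exists>t'\<in>Clo \<A> k. ?d f' t' \<le> ?d f t" if f': "f' \<in> funs \<A> k" for f'
  proof -
    have "Prim_k \<A> k \<le> ?M f'"
      unfolding Prim_k_def using f' by (intro Min_le) (auto simp: finite_funs)
    moreover obtain t' where t': "t' \<in> Clo \<A> k" "?M f' = coincidence_ratio \<A> k f' t'"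
      using M_in by blast
    ultimately have "real (?d f' t') \<le> real (?d f t)"
      using card_universe_pos eq
      by (simp add: coincidence_ratio_defect[of k f' t'] divide_le_cancel)
    then show ?thesis using t'(1) by auto
  qed
  ultimately show ?thesis by blast
qed

lemma Prim_k_nonneg:
  assumes "k \<ge> 1"
  shows "Prim_k \<A> k \<ge> 0"
proof -
  have "(MAX t\<in>Clo \<A> k. coincidence_ratio \<A> k f t) \<ge> 0" for f
  proof -
    obtain t where "t \<in> Clo \<A> k" using Clo_nonempty[OF assms] by blast
    then have "coincidence_ratio \<A> k f t \<le> (MAX t\<in>Clo \<A> k. coincidence_ratio \<A> k f t)"
      by (intro Max_ge) (simp_all add: finite_Clo)
    moreover have "coincidence_ratio \<A> k f t \<ge> 0" by (simp add: coincidence_ratio_def)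
    ultimately show ?thesis by linarith
  qed
  then show ?thesis
    unfolding Prim_k_def by (intro Min.boundedI) (auto simp: finite_funs funs_nonempty)
qed


section \<open>Distinct probabilities\<close>

lemma exists_fun_with_agreement:
  assumes "nontrivial \<A>" "i < k" "j \<le> card (universe \<A>) ^ k"
  obtains f where "f \<in> funs \<A> k" "card {xs \<in> tuples (universe \<A>) k. f xs = xs ! i} = j"
proof -
  let ?T = "tuples (universe \<A>) k"
  from assms(3) obtain S where S: "S \<subseteq> ?T" "card S = j"
    using obtain_subset_with_card_n card_tuples by metis
  have "\<exists>b\<in>universe \<A>. b \<noteq> a" for a
    using assms(1) unfolding nontrivial_def by metis
  then obtain s where s: "\<And>a. s a \<in> universe \<A>" "\<And>a. s a \<noteq> a" by metis
  let ?f = "\<lambda>xs\<in>?T. if xs \<in> S then xs ! i else s (xs ! i)"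
  show thesis
  proof
    have "xs ! i \<in> universe \<A>" if "xs \<in> ?T" for xs
      using that assms(2) by (auto simp: tuples_def)
    then show "?f \<in> funs \<A> k" using s(1) by (auto simp: funs_def)
    have "{xs \<in> ?T. ?f xs = xs ! i} = S" using S(1) s(2) by auto
    then show "card {xs \<in> ?T. ?f xs = xs ! i} = j" using S(2) by simp
  qed
qed

lemma card_agreement_perturb:
  "card {xs \<in> tuples (universe \<A>) k. f xs = h xs} \<le>
    card {xs \<in> tuples (universe \<A>) k. g xs = h xs} + card {xs \<in> tuples (universe \<A>) k. f xs \<noteq> g xs}"
  (is "card ?F \<le> card ?G + card ?D")
proof -
  have "card ?F \<le> card (?G \<union> ?D)" by (rule card_mono) (auto simp: finite_tuples)
  also have "\<dots> \<le> card ?G + card ?D" by (rule card_Un_le)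
  finally show ?thesis .
qed

text \<open>For each \<open>i \<le> n ^ k div (2 * e + 1)\<close> there is a function that agrees with the projection
  in \<open>i * (2 * e + 1)\<close> points. A term function approximating it changes this number by at most
  \<open>e\<close>, and the intervals of radius \<open>e\<close> around these numbers are disjoint.\<close>

lemma card_PSpec_greater:
  assumes "nontrivial \<A>" "k \<ge> 1" "finite (PSpec \<A>)"
    and approx: "\<forall>f\<in>funs \<A> k. \<exists>t\<in>Clo \<A> k. card {xs \<in> tuples (universe \<A>) k. f xs \<noteq> t xs} \<le> e"
  shows "card (universe \<A>) ^ k div (2 * e + 1) < card (PSpec \<A>)"
proof -
  let ?T = "tuples (universe \<A>) k"
  let ?n = "card (universe \<A>)"
  let ?m = "?n ^ k div (2 * e + 1)"
  have "\<forall>i\<in>{..?m}. \<exists>c. real c / real ?n ^ k \<in> PSpec \<A> \<and>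
    c \<le> i * (2 * e + 1) + e \<and> i * (2 * e + 1) \<le> c + e"
  proof
    fix i assume "i \<in> {..?m}"
    then have "i \<le> ?m" by simp
    have "i * (2 * e + 1) \<le> ?n ^ k"
      using mult_le_mono1[OF \<open>i \<le> ?m\<close>, of "2 * e + 1"] div_times_less_eq_dividend[of "?n ^ k" "2 * e + 1"]
      by linarith
    moreover have "0 < k" using assms(2) by simp
    ultimately obtain f where f: "f \<in> funs \<A> k" "card {xs \<in> ?T. f xs = xs ! 0} = i * (2 * e + 1)"
      using exists_fun_with_agreement[OF assms(1)] by metis
    obtain t where t: "t \<in> Clo \<A> k" "card {xs \<in> ?T. f xs \<noteq> t xs} \<le> e" using approx f(1) by blast
    moreover have "{xs \<in> ?T. t xs \<noteq> f xs} = {xs \<in> ?T. f xs \<noteq> t xs}" by auto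
    ultimately have t': "card {xs \<in> ?T. t xs \<noteq> f xs} \<le> e" by simp
    let ?c = "card {xs \<in> ?T. t xs = xs ! 0}"
    have "real ?c / real ?n ^ k \<in> PSpec \<A>"
      using agreement_with_projection_in_PSpec[OF t(1), of 0] assms(2) by simp
    moreover have "?c \<le> i * (2 * e + 1) + e"
      using card_agreement_perturb[of k t "\<lambda>xs. xs ! 0" f] f(2) t' by linarith
    moreover have "i * (2 * e + 1) \<le> ?c + e"
      using card_agreement_perturb[of k f "\<lambda>xs. xs ! 0" t] f(2) t(2) by linarith
    ultimately show "\<exists>c. real c / real ?n ^ k \<in> PSpec \<A> \<and>
      c \<le> i * (2 * e + 1) + e \<and> i * (2 * e + 1) \<le> c + e" by blast
  qed
  from bchoice[OF this] obtain c where "\<forall>i\<in>{..?m}. real (c i) / real ?n ^ k \<in> PSpec \<A> \<and>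
    c i \<le> i * (2 * e + 1) + e \<and> i * (2 * e + 1) \<le> c i + e" ..
  then have c: "real (c i) / real ?n ^ k \<in> PSpec \<A>" "c i \<le> i * (2 * e + 1) + e"
    "i * (2 * e + 1) \<le> c i + e" if "i \<le> ?m" for i
    using that unfolding Ball_def atMost_iff by blast+
  \<comment> \<open>\<open>c i\<close> is within \<open>e\<close> of a multiple of \<open>2 * e + 1\<close>, so rounding recovers \<open>i\<close>.\<close>
  have recover: "(c i + e) div (2 * e + 1) = i" if "i \<le> ?m" for i
  proof (rule div_nat_eqI)
    show "(2 * e + 1) * i \<le> c i + e"
      using c(3)[OF that] by (simp only: mult.commute)
    show "c i + e < (2 * e + 1) * Suc i"
      unfolding mult_Suc_right mult.commute[of "2 * e + 1" i] using c(2)[OF that] by linarith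
  qed
  have "inj_on (\<lambda>i. real (c i) / real ?n ^ k) {..?m}"
  proof (rule inj_onI)
    fix i j assume ij: "i \<in> {..?m}" "j \<in> {..?m}" "real (c i) / real ?n ^ k = real (c j) / real ?n ^ k"
    then have "c i = c j" using card_universe_pos by simp
    then show "i = j" using recover[of i] recover[of j] ij(1,2) unfolding atMost_iff by metis
  qed
  moreover have "(\<lambda>i. real (c i) / real ?n ^ k) ` {..?m} \<subseteq> PSpec \<A>"
    using c(1) by (simp add: image_subset_iff)
  ultimately have "card {..?m} \<le> card (PSpec \<A>)"
    by (rule card_inj_on_le[OF _ _ assms(3)])
  then show ?thesis by simp
qed


section \<open>The bound\<close>

lemma primality_bound_Prim_k:
  assumes "nontrivial \<A>" "k \<ge> 1" "Prim_k \<A> k < 1"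
  shows "primality_bound (Prim_k \<A> k) \<le> ecard (PSpec \<A>)"
proof (cases "finite (PSpec \<A>)")
  case True
  let ?N = "card (universe \<A>) ^ k"
  obtain e where e: "Prim_k \<A> k = 1 - real e / real (card (universe \<A>)) ^ k"
    "\<forall>f\<in>funs \<A> k. \<exists>t\<in>Clo \<A> k. card {xs \<in> tuples (universe \<A>) k. f xs \<noteq> t xs} \<le> e"
    using Prim_k_defect[OF assms(2)] by blast
  have "e \<noteq> 0" using e(1) assms(3) by (intro notI) simp
  have "1 / (4 * (1 - Prim_k \<A> k)) = real ?N / real (4 * e)"
    using e(1) by simp
  then have "nat \<lfloor>1 / (4 * (1 - Prim_k \<A> k))\<rfloor> = ?N div (4 * e)"
    by (simp only: floor_divide_of_nat_eq nat_int)
  also have "\<dots> \<le> ?N div (2 * e + 1)"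
    using \<open>e \<noteq> 0\<close> by (intro div_le_mono2) auto
  also have "\<dots> \<le> card (PSpec \<A>)"
    using card_PSpec_greater[OF assms(1,2) True e(2)] by simp
  finally show ?thesis using assms(3) True by (simp add: primality_bound_def ecard_def)
qed (simp add: ecard_def)

lemma infinite_PSpec:
  assumes "nontrivial \<A>" "\<And>k. k \<ge> 1 \<Longrightarrow> Prim_k \<A> k \<ge> 1"
  shows "infinite (PSpec \<A>)"
proof
  assume fin: "finite (PSpec \<A>)"
  obtain a b where "a \<in> universe \<A>" "b \<in> universe \<A>" "a \<noteq> b"
    using assms(1) by (auto simp: nontrivial_def)
  then have two: "card (universe \<A>) \<ge> 2"
    using card_mono[OF finite_universe, of "{a, b}"] by auto
  \<comment> \<open>An arity for which \<open>2 ^ k\<close>, hence \<open>n ^ k\<close>, exceeds the supposed size of the spectrum.\<close>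
  define k where "k = Suc (card (PSpec \<A>))"
  have k: "k \<ge> 1" by (simp add: k_def)
  obtain e where e: "Prim_k \<A> k = 1 - real e / real (card (universe \<A>)) ^ k"
    "\<forall>f\<in>funs \<A> k. \<exists>t\<in>Clo \<A> k. card {xs \<in> tuples (universe \<A>) k. f xs \<noteq> t xs} \<le> e"
    using Prim_k_defect[OF k] by blast
  have "e = 0"
  proof (rule ccontr)
    assume "e \<noteq> 0"
    then have "real e / real (card (universe \<A>)) ^ k > 0"
      using card_universe_pos by (intro divide_pos_pos zero_less_power) simp_all
    then show False using e(1) assms(2)[OF k] by linarith
  qed
  then have "card (universe \<A>) ^ k < card (PSpec \<A>)"
    using card_PSpec_greater[OF assms(1) k fin e(2)] by simp
  moreover have "2 ^ k \<le> card (universe \<A>) ^ k" using two by (rule power_mono) simp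
  moreover have "k < 2 ^ k" by simp
  ultimately show False by (simp add: k_def)
qed

lemma Prim_le_Prim_k:
  assumes "k \<ge> 1"
  shows "Prim \<A> \<le> Prim_k \<A> k"
  unfolding Prim_def
  by (rule cINF_lower) (use assms Prim_k_nonneg in \<open>auto intro!: bdd_belowI2[of _ 0]\<close>)

end

lemma primality_bound_mono:
  assumes "p \<le> q" "q < 1"
  shows "primality_bound p \<le> primality_bound q"
proof -
  have "1 / (4 * (1 - p)) \<le> 1 / (4 * (1 - q))"
    using assms by (intro divide_left_mono) auto
  then show ?thesis using assms by (auto simp: primality_bound_def intro!: nat_mono floor_mono)
qed

theorem theorem6p2:
  fixes \<A> :: "('f, 'a) algebra"
  assumes "finite_algebra \<A>" and "nontrivial \<A>"
  shows "ecard (PSpec \<A>) \<ge> (SUP k\<in>{k. k \<ge> 1 \<and> Prim_k \<A> k < 1}. primality_bound (Prim_k \<A> k))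
    \<and> ecard (PSpec \<A>) \<ge> primality_bound (Prim \<A>)"
proof
  interpret finite_algebra \<A> by fact
  note bound = primality_bound_Prim_k[OF assms(2)]
  show "ecard (PSpec \<A>) \<ge> (SUP k\<in>{k. k \<ge> 1 \<and> Prim_k \<A> k < 1}. primality_bound (Prim_k \<A> k))"
    by (rule SUP_least) (auto intro: bound)
  show "ecard (PSpec \<A>) \<ge> primality_bound (Prim \<A>)"
  proof (cases "\<exists>k\<ge>1. Prim_k \<A> k < 1")
    case True
    then obtain k where k: "k \<ge> 1" "Prim_k \<A> k < 1" by blast
    have "primality_bound (Prim \<A>) \<le> primality_bound (Prim_k \<A> k)"
      by (rule primality_bound_mono[OF Prim_le_Prim_k[OF k(1)] k(2)])
    also have "\<dots> \<le> ecard (PSpec \<A>)" using k by (rule bound)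
    finally show ?thesis .
  next
    case False
    then have "infinite (PSpec \<A>)" using assms(2) by (intro infinite_PSpec) auto
    then show ?thesis by (simp add: ecard_def)
  qed
qed

end
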